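(* Let $\mathcal{T}\ge1$, $n\ge 1$, $\epsilon>0$, let $C\in\mathbb{R}^{n\times n}$, and let $\mathbf{C}\in\mathbb{R}^{n^{\mathcal{T}+1}}$ be the tensor with elements $$\mathbf{C}_{i_0,\dots,i_{\mathcal{T}}}=\sum_{t=1}^{\mathcal{T}}C_{i_{t-1},i_t}.$$ Let $\mathbf{K}=\exp(-\mathbf{C}/\epsilon)$, $K=\exp(-C/\epsilon)$ (elementwise exponentials), and $\mathbf{U}=u_0\otimes u_1\otimes\cdots\otimes u_{\mathcal{T}}$ with $u_0,\dots,u_{\mathcal{T}}\in\mathbb{R}^n$. Then, for $0\le t\le\mathcal{T}$, $$P_t(\mathbf{K}\odot\mathbf{U})=\left(u_0^TK\,\mathrm{diag}(u_1)K\cdots K\,\mathrm{diag}(u_{t-1})K\right)^T\odot u_t\odot\left(K\,\mathrm{diag}(u_{t+1})K\cdots K\,\mathrm{diag}(u_{\mathcal{T}-1})Ku_{\mathcal{T}}\right),$$ and, for $0\le t_1<t_2\le\mathcal{T}$, $$\begin{aligned}P_{t_1,t_2}(\mathbf{K}\odot\mathbf{U})=\ &\mathrm{diag}\left(u_0^TK\,\mathrm{diag}(u_1)K\cdots K\,\mathrm{diag}(u_{t_1-1})K\right)\\&\cdot\ \mathrm{diag}(u_{t_1})K\,\mathrm{diag}(u_{t_1+1})K\cdots K\,\mathrm{diag}(u_{t_2-1})K\,\mathrm{diag}(u_{t_2})\\&\cdot\ \mathrm{diag}\left(K\,\mathrm{diag}(u_{t_2+1})K\cdots K\,\mathrm{diag}(u_{\mathcal{T}-1})Ku_{\mathcal{T}}\right),\end{aligned}$$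 where $\cdot$ denotes the matrix product.
   Context: Tensors in $\mathbb{R}^{n^{\mathcal{T}+1}}$ are real arrays indexed by $(i_0,\dots,i_{\mathcal{T}})\in\{1,\dots,n\}^{\mathcal{T}+1}$; $\odot$ is elementwise multiplication; $(u_0\otimes\cdots\otimes u_{\mathcal{T}})_{i_0,\dots,i_{\mathcal{T}}}=\prod_{t=0}^{\mathcal{T}}(u_t)_{i_t}$; $\mathrm{diag}(u)$ is the diagonal matrix with the entries of the (row or column) vector $u$ on its diagonal. The projection on the $t$-th marginal is the vector $P_t(\mathbf{M})\in\mathbb{R}^n$ with $P_t(\mathbf{M})_j=\sum\mathbf{M}_{i_0,\dots,i_{\mathcal{T}}}$, the sum being over all indices with $i_t=j$ fixed; the bi-marginal projection is the matrix $P_{t_1,t_2}(\mathbf{M})\in\mathbb{R}^{n\times n}$ with $P_{t_1,t_2}(\mathbf{M})_{j,\ell}=\sum\mathbf{M}_{i_0,\dots,i_{\mathcal{T}}}$, the sum being over all indices with $i_{t_1}=j$ and $i_{t_2}=\ell$ fixed. Conventions for end cases: the left factor $u_0^TK\,\mathrm{diag}(u_1)K\cdots K\,\mathrm{diag}(u_{s-1})K$ is $\mathbf{1}^T\mathrm{diag}(u_0)K\,\mathrm{diag}(u_1)K\cdots\mathrm{diag}(u_{s-1})K$, which is the all-ones row vector $\mathbf{1}^T$ when $s=0$; the right factor $K\,\mathrm{diag}(u_{s+1})K\cdots K\,\mathrm{diag}(u_{\mathcal{T}-1})Ku_{\mathcal{T}}$ is $K\,\mathrm{diag}(u_{s+1})K\cdots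 K\,\mathrm{diag}(u_{\mathcal{T}})\mathbf{1}$, which is the all-ones vector $\mathbf{1}$ when $s=\mathcal{T}$; when $t_2=t_1+1$ the middle factor is $\mathrm{diag}(u_{t_1})K\,\mathrm{diag}(u_{t_2})$. *)

theory Defs
  imports "HOL-Analysis.Analysis"
begin

(* The index set {1,...,n} is the finite type 'n.  A multi-index (i_0,...,i_T) is a function
   from {0..T} to 'n, extended by undefined so that there are exactly n^(T+1) of them.
   A tensor is a function of multi-indices; only its values on multi_indices T matter.
   Elementwise multiplication of vectors is the library's ( * ) on real^'n, and 1 :: real^'n
   is the all-ones vector.  Row and column vectors share the type real^'n. *)

type_synonym 'n tensor = "(nat \<Rightarrow> 'n) \<Rightarrow> real"

definition multi_indices :: "nat \<Rightarrow> (nat \<Rightarrow> 'n::finite) set" where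
  "multi_indices T = {0..T} \<rightarrow>\<^sub>E UNIV"

definition cost_tensor :: "nat \<Rightarrow> real^'n^'n \<Rightarrow> 'n::finite tensor" where
  "cost_tensor T C = (\<lambda>i. \<Sum>t=1..T. C $ i (t - 1) $ i t)"

definition outer_tensor :: "nat \<Rightarrow> (nat \<Rightarrow> real^'n) \<Rightarrow> 'n::finite tensor" where
  "outer_tensor T u = (\<lambda>i. \<Prod>t=0..T. u t $ i t)"

definition tensor_mult :: "'n tensor \<Rightarrow> 'n tensor \<Rightarrow> 'n tensor" (infixl "\<odot>" 70) where
  "M \<odot> N = (\<lambda>i. M i * N i)"

definition tensor_proj :: "nat \<Rightarrow> nat \<Rightarrow> 'n::finite tensor \<Rightarrow> real^'n" where
  "tensor_proj T t M = (\<chi> j. \<Sum>i | i \<in> multi_indices T \<and> i t = j. M i)"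

definition tensor_biproj :: "nat \<Rightarrow> nat \<Rightarrow> nat \<Rightarrow> 'n::finite tensor \<Rightarrow> real^'n^'n" where
  "tensor_biproj T t1 t2 M =
     (\<chi> j l. \<Sum>i | i \<in> multi_indices T \<and> i t1 = j \<and> i t2 = l. M i)"

definition diag :: "real^'n \<Rightarrow> real^'n^'n::finite" where
  "diag v = (\<chi> i j. if i = j then v $ i else 0)"

definition mat_list_prod :: "(real^'n^'n) list \<Rightarrow> real^'n^'n::finite" where
  "mat_list_prod As = foldr (**) As (mat 1)"

(* 1^T diag(u_0) K diag(u_1) K ... diag(u_(s-1)) K, which is 1^T for s = 0 *)
definition left_factor :: "real^'n^'n \<Rightarrow> (nat \<Rightarrow> real^'n) \<Rightarrow> nat \<Rightarrow> real^'n::finite" where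
  "left_factor K u s = 1 v* mat_list_prod (map (\<lambda>r. diag (u r) ** K) [0..<s])"

(* K diag(u_(s+1)) K ... K diag(u_T) 1, which is 1 for s = T *)
definition right_factor :: "nat \<Rightarrow> real^'n^'n \<Rightarrow> (nat \<Rightarrow> real^'n) \<Rightarrow> nat \<Rightarrow> real^'n::finite" where
  "right_factor T K u s = mat_list_prod (map (\<lambda>r. K ** diag (u r)) [s+1..<T+1]) *v 1"

(* diag(u_t1) K diag(u_(t1+1)) K ... K diag(u_t2), for t1 < t2 *)
definition middle_factor ::
    "real^'n^'n \<Rightarrow> (nat \<Rightarrow> real^'n) \<Rightarrow> nat \<Rightarrow> nat \<Rightarrow> real^'n^'n::finite" where
  "middle_factor K u t1 t2 =
     diag (u t1) ** mat_list_prod (map (\<lambda>r. K ** diag (u r)) [t1+1..<t2+1])"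

end

theory Submission
  imports Defs
begin

text \<open>
  Restricting a sum over multi-indices to \<open>i\<^sub>t = j\<close> amounts to summing over all multi-indices after
  replacing \<open>u\<^sub>t\<close> by its product with the \<open>j\<close>-th unit vector. So both formulas reduce to the total
  mass of \<open>K \<odot> U\<close>, which is a product of matrices: with \<open>L\<^sub>t\<close> and \<open>R\<^sub>t\<close> the left and right
  factors, the mass equals \<open>(L\<^sub>T u\<^sub>T) \<bullet> 1\<close> by adding one time step at a time, and
  \<open>(L\<^sub>t u\<^sub>t) \<bullet> R\<^sub>t\<close> does not depend on \<open>t\<close> because \<open>K\<close> can be moved across the inner product.
\<close>

lemma diag_mult_vec: "diag v *v x = v * x"
  by (simp add: vec_eq_iff diag_def matrix_vector_mult_def if_distrib[where f = "\<lambda>a. a * _"]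
      cong: if_cong)

lemma vec_mult_diag: "x v* diag v = x * v"
  by (simp add: vec_eq_iff diag_def vector_matrix_mult_def if_distrib[where f = "\<lambda>a. a * _"]
      if_distrib[where f = "\<lambda>a. _ * a"] mult.commute cong: if_cong)

lemma diag_mult: "diag (v * w) = diag v ** diag w"
  by (simp add: matrix_eq diag_mult_vec mult.assoc flip: matrix_vector_mul_assoc)

lemma diag_matrix_diag_nth: "(diag v ** A ** diag w) $ j $ l = v $ j * A $ j $ l * w $ l"
  by (simp add: diag_def matrix_matrix_mult_def if_distrib[where f = "\<lambda>a. a * _"]
      if_distrib[where f = "\<lambda>a. _ * a"] cong: if_cong)

lemma inner_mult_vec_left: "(x * y) \<bullet> z = x \<bullet> (y * z)" for x y z :: "real^'n"
  by (simp add: inner_vec_def mult.assoc)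

lemma inner_axis_mult: "x \<bullet> (axis j 1 * y) = x $ j * y $ j" for x y :: "real^'n"
  by (simp add: inner_vec_def axis_def if_distrib[where f = "\<lambda>a. a * _"]
      if_distrib[where f = "\<lambda>a. _ * a"] cong: if_cong)

text \<open>Unit-vector diagonals annihilate every entry of \<open>A\<close> except the one at
  \<open>(j, l)\<close>. This turns the total mass of a restricted tensor into a single entry of the
  bi-marginal.\<close>

lemma inner_diag_axis_matrix:
  "x \<bullet> ((diag (axis j 1) ** A ** diag (axis l 1)) *v y) = x $ j * A $ j $ l * y $ l"
proof -
  have "(A *v (axis l 1 * y)) $ j = A $ j $ l * y $ l"
    by (simp add: matrix_vector_mul_component inner_axis_mult)
  then show ?thesis
    by (simp add: diag_mult_vec inner_axis_mult flip: matrix_vector_mul_assoc)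
qed

lemma mat_list_prod_append: "mat_list_prod (As @ Bs) = mat_list_prod As ** mat_list_prod Bs"
  by (induction As) (simp_all add: mat_list_prod_def matrix_mul_assoc)

lemma mat_list_prod_single: "mat_list_prod [A] = A"
  by (simp add: mat_list_prod_def)

lemma left_factor_0: "left_factor K u 0 = 1"
  by (simp add: left_factor_def mat_list_prod_def)

lemma left_factor_Suc: "left_factor K u (Suc t) = (left_factor K u t * u t) v* K"
  by (simp add: left_factor_def mat_list_prod_append mat_list_prod_single vec_mult_diag
      flip: vector_matrix_mul_assoc)

lemma left_factor_cong: "(\<And>r. r < t \<Longrightarrow> u r = v r) \<Longrightarrow> left_factor K u t = left_factor K v t"
  unfolding left_factor_def by (intro arg_cong[where f = "\<lambda>As. 1 v* mat_list_prod As"] map_cong) auto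

lemma right_factor_end: "right_factor T K u T = 1"
  by (simp add: right_factor_def mat_list_prod_def)

text \<open>Cutting the range of time steps at \<open>t2\<close> splits the right factor at
  \<open>t1\<close>; this exposes the middle factor inside the total mass evaluated at
  \<open>t1\<close>.\<close>

lemma middle_factor_mult_right_factor:
  assumes "t1 \<le> t2" "t2 \<le> T"
  shows "middle_factor K u t1 t2 *v right_factor T K u t2 = u t1 * right_factor T K u t1"
proof -
  have "[t1 + 1..<T + 1] = [t1 + 1..<t2 + 1] @ [t2 + 1..<T + 1]"
    using assms upt_add_eq_append[of "t1 + 1" "t2 + 1" "T - t2"] by simp
  then show ?thesis
    by (simp add: middle_factor_def right_factor_def mat_list_prod_append diag_mult_vec
        del: upt_Suc flip: matrix_vector_mul_assoc)
qed

lemma right_factor_step: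
  assumes "t < T"
  shows "right_factor T K u t = K *v (u (Suc t) * right_factor T K u (Suc t))"
proof -
  have "[t + 1..<T + 1] = [Suc t] @ [Suc t + 1..<T + 1]"
    using assms by (simp add: upt_conv_Cons del: upt_Suc)
  then show ?thesis
    by (simp add: right_factor_def mat_list_prod_append mat_list_prod_single diag_mult_vec
        del: upt_Suc append.simps flip: matrix_vector_mul_assoc)
qed

lemma right_factor_cong:
  "(\<And>r. t < r \<Longrightarrow> u r = v r) \<Longrightarrow> right_factor T K u t = right_factor T K v t"
  unfolding right_factor_def by (intro arg_cong[where f = "\<lambda>As. mat_list_prod As *v 1"] map_cong) auto

text \<open>\<open>diag\<close> is multiplicative, and the vectors \<open>u t1\<close> and
  \<open>u t2\<close> enter only through the outermost diagonals, so \<open>v\<close> and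
  \<open>w\<close> can be pulled out on either side.\<close>

lemma middle_factor_update_ends:
  assumes "t1 < t2"
  shows "middle_factor K (u(t1 := v * u t1, t2 := u t2 * w)) t1 t2
           = diag v ** middle_factor K u t1 t2 ** diag w"
proof -
  define u' where "u' = u(t1 := v * u t1, t2 := u t2 * w)"
  have ends: "u' t1 = v * u t1" "u' t2 = u t2 * w"
    using assms by (simp_all add: u'_def)
  have split: "[t1 + 1..<t2 + 1] = [t1 + 1..<t2] @ [t2]"
    using assms by simp
  have inner: "map (\<lambda>r. K ** diag (u' r)) [t1 + 1..<t2] = map (\<lambda>r. K ** diag (u r)) [t1 + 1..<t2]"
    by (auto simp: u'_def)
  have "middle_factor K u' t1 t2 = diag v ** middle_factor K u t1 t2 ** diag w"
    unfolding middle_factor_def split map_append inner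
    by (simp add: mat_list_prod_append mat_list_prod_single ends diag_mult matrix_mul_assoc)
  then show ?thesis
    by (simp add: u'_def)
qed

lemma sum_PiE_insert:
  assumes "a \<notin> A"
  shows "(\<Sum>i\<in>PiE (insert a A) B. F i) = (\<Sum>k\<in>B a. \<Sum>i\<in>PiE A B. F (i(a := k)))"
  \<comment> \<open>The extended functions are the image of the pairs \<open>(k, i)\<close> under
    \<open>i(a := k)\<close>, which is injective because \<open>a\<close> lies outside
    \<open>A\<close>.\<close>
  unfolding PiE_insert_eq
  by (subst sum.reindex)
     (use inj_combinator[OF assms, of B] in \<open>simp_all add: sum.cartesian_product split_def\<close>)

lemma sum_multi_indices_0:
  "(\<Sum>i\<in>multi_indices 0. F i) = (\<Sum>k\<in>UNIV. F ((\<lambda>_. undefined)(0 := k)))"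
  by (simp add: multi_indices_def sum_PiE_insert fun_upd_def)

lemma sum_multi_indices_Suc:
  "(\<Sum>i\<in>multi_indices (Suc T). F i) = (\<Sum>i\<in>multi_indices T. \<Sum>k\<in>UNIV. F (i(Suc T := k)))"
  unfolding multi_indices_def atLeast0_atMost_Suc
  by (subst sum.swap) (simp add: sum_PiE_insert)

text \<open>The exponential of a sum of costs is a product of entries of \<open>K\<close>. From here
  on \<open>K\<close> can be an arbitrary matrix.\<close>

definition path_tensor :: "nat \<Rightarrow> real^'n^'n \<Rightarrow> 'n::finite tensor" where
  "path_tensor T K = (\<lambda>i. \<Prod>t=1..T. K $ i (t - 1) $ i t)"

lemma exp_cost_tensor:
  "exp (- cost_tensor T C i / \<epsilon>) = path_tensor T (\<chi> i j. exp (- (C $ i $ j) / \<epsilon>)) i"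
  by (simp add: cost_tensor_def path_tensor_def sum_negf sum_divide_distrib flip: exp_sum)

lemma path_outer_Suc:
  "(path_tensor (Suc T) K \<odot> outer_tensor (Suc T) u) (i(Suc T := k))
     = (path_tensor T K \<odot> outer_tensor T u) i * (K $ i T $ k * u (Suc T) $ k)"
proof -
  have "(\<Prod>t=1..T. K $ (i(Suc T := k)) (t - 1) $ (i(Suc T := k)) t)
      = (\<Prod>t=1..T. K $ i (t - 1) $ i t)"
    by (rule prod.cong) auto
  moreover have "(\<Prod>t=0..T. u t $ (i(Suc T := k)) t) = (\<Prod>t=0..T. u t $ i t)"
    by (rule prod.cong) auto
  ultimately show ?thesis
    by (simp add: tensor_mult_def path_tensor_def outer_tensor_def del: fun_upd_apply) simp
qed

text \<open>The free weight \<open>v\<close> on the last index makes the induction work: summing out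
  the newest index only changes the weight on the previous one.\<close>

lemma sum_path_outer_end:
  "(\<Sum>i\<in>multi_indices T. (path_tensor T K \<odot> outer_tensor T u) i * v $ i T)
     = (left_factor K u T * u T) \<bullet> v"
proof (induction T arbitrary: v)
  case 0
  show ?case
    by (simp add: sum_multi_indices_0 tensor_mult_def path_tensor_def outer_tensor_def
        left_factor_0 inner_vec_def)
next
  case (Suc T)
  have "(\<Sum>i\<in>multi_indices (Suc T).
          (path_tensor (Suc T) K \<odot> outer_tensor (Suc T) u) i * v $ i (Suc T))
      = (\<Sum>i\<in>multi_indices T. (path_tensor T K \<odot> outer_tensor T u) i
          * (K *v (u (Suc T) * v)) $ i T)"
    by (simp add: sum_multi_indices_Suc path_outer_Suc matrix_vector_mult_def
        sum_distrib_left mult.assoc)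
  also have "\<dots> = (left_factor K u (Suc T) * u (Suc T)) \<bullet> v"
    \<comment> \<open>The induction hypothesis is used with weight
      \<open>K *v (u (Suc T) * v)\<close>, and \<open>K\<close> then crosses the inner product. The
      instantiation keeps the product \<open>left_factor K u T * u T\<close> intact.\<close>
    by (simp add: Suc.IH left_factor_Suc dot_lmul_matrix inner_mult_vec_left[of "_ v* _"])
  finally show ?case .
qed

text \<open>Downward induction from \<open>T\<close>, where the weight is the all-ones vector; each
  step moves one \<open>K\<close> from the left factor to the right one.\<close>

lemma total_mass:
  assumes "t \<le> T"
  shows "(\<Sum>i\<in>multi_indices T. (path_tensor T K \<odot> outer_tensor T u) i)
           = left_factor K u t \<bullet> (u t * right_factor T K u t)"
  using assms
proof (induction t rule: inc_induct)
  case base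
  show ?case
    using sum_path_outer_end[of T K u 1] by (simp add: right_factor_end inner_mult_vec_left)
next
  case (step t)
  then show ?case
    by (simp add: left_factor_Suc right_factor_step dot_lmul_matrix inner_mult_vec_left)
qed

lemma outer_tensor_update:
  assumes "t \<le> T"
  shows "outer_tensor T (u(t := u t * v)) i = outer_tensor T u i * v $ i t"
proof -
  have "outer_tensor T (u(t := u t * v)) i
      = (\<Prod>s=0..T. u s $ i s * (if s = t then v $ i s else 1))"
    unfolding outer_tensor_def by (rule prod.cong) auto
  also have "\<dots> = outer_tensor T u i * v $ i t"
    using assms by (simp add: outer_tensor_def prod.distrib)
  finally show ?thesis .
qed

lemma finite_multi_indices: "finite (multi_indices T)"
  by (simp add: multi_indices_def finite_PiE)

lemma tensor_proj_path_outer: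
  assumes "t \<le> T"
  shows "tensor_proj T t (path_tensor T K \<odot> outer_tensor T u)
           = left_factor K u t * u t * right_factor T K u t"
proof (rule vec_eq_iff[THEN iffD2], rule allI)
  fix j
  define u' where "u' = u(t := u t * axis j 1)"
  have "tensor_proj T t (path_tensor T K \<odot> outer_tensor T u) $ j
      = (\<Sum>i\<in>multi_indices T. (path_tensor T K \<odot> outer_tensor T u') i)"
    using assms unfolding u'_def
    by (simp add: tensor_proj_def tensor_mult_def outer_tensor_update axis_def
        finite_multi_indices sum.If_cases Int_def if_distrib[where f = "\<lambda>a. _ * a"] cong: if_cong)
  also have "\<dots> = left_factor K u t \<bullet> (u' t * right_factor T K u t)"
    \<comment> \<open>The left factor sees only times before \<open>t\<close> and the right factor
      only times after it, so neither notices the change at \<open>t\<close>.\<close>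
    using left_factor_cong[of t u' u K] right_factor_cong[of t u' u T K]
    by (simp add: total_mass[OF assms] u'_def)
  also have "\<dots> = (left_factor K u t * u t * right_factor T K u t) $ j"
    using inner_axis_mult[of "left_factor K u t" j "u t * right_factor T K u t"]
    by (simp add: u'_def mult_ac)
  finally show "tensor_proj T t (path_tensor T K \<odot> outer_tensor T u) $ j
      = (left_factor K u t * u t * right_factor T K u t) $ j" .
qed

lemma tensor_biproj_path_outer:
  assumes "t1 < t2" "t2 \<le> T"
  shows "tensor_biproj T t1 t2 (path_tensor T K \<odot> outer_tensor T u)
           = diag (left_factor K u t1) ** middle_factor K u t1 t2 ** diag (right_factor T K u t2)"
proof -
  have "tensor_biproj T t1 t2 (path_tensor T K \<odot> outer_tensor T u) $ j $ l
      = left_factor K u t1 $ j * middle_factor K u t1 t2 $ j $ l * right_factor T K u t2 $ l" for j l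
  proof -
    define u' where "u' = u(t1 := axis j 1 * u t1, t2 := u t2 * axis l 1)"
    have outer: "outer_tensor T u' i
        = (if i t1 = j \<and> i t2 = l then outer_tensor T u i else 0)" for i
      using assms outer_tensor_update[of t1 T u "axis j 1" i]
        outer_tensor_update[of t2 T "u(t1 := axis j 1 * u t1)" "axis l 1" i]
      by (simp add: u'_def axis_def mult.commute)
    have "tensor_biproj T t1 t2 (path_tensor T K \<odot> outer_tensor T u) $ j $ l
        = (\<Sum>i\<in>multi_indices T. (path_tensor T K \<odot> outer_tensor T u') i)"
      by (simp add: tensor_biproj_def tensor_mult_def outer
          finite_multi_indices sum.If_cases Int_def if_distrib[where f = "\<lambda>a. _ * a"] cong: if_cong)
    \<comment> \<open>The mass is evaluated at \<open>t1\<close>, so that both modified vectors end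
      up in the middle factor.\<close>
    also have "\<dots> = left_factor K u' t1 \<bullet> (middle_factor K u' t1 t2 *v right_factor T K u' t2)"
      using assms by (simp add: total_mass[of t1] middle_factor_mult_right_factor)
    also have "\<dots> = left_factor K u t1 \<bullet> ((diag (axis j 1) ** middle_factor K u t1 t2
        ** diag (axis l 1)) *v right_factor T K u t2)"
      using assms left_factor_cong[of t1 u' u K] right_factor_cong[of t2 u' u T K]
      by (simp add: u'_def middle_factor_update_ends)
    finally show ?thesis
      by (simp add: inner_diag_axis_matrix)
  qed
  then show ?thesis
    by (simp add: vec_eq_iff diag_matrix_diag_nth)
qed

theorem proposition1:
  fixes T :: nat and \<epsilon> :: real
    and C K :: "real^'n^'n"
    and KK UU :: "'n::finite tensor"
    and u :: "nat \<Rightarrow> real^'n"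
  assumes "T \<ge> 1" and "\<epsilon> > 0"
    and "KK = (\<lambda>i. exp (- cost_tensor T C i / \<epsilon>))"
    and "K = (\<chi> i j. exp (- (C $ i $ j) / \<epsilon>))"
    and "UU = outer_tensor T u"
  shows "(\<forall>t\<le>T. tensor_proj T t (KK \<odot> UU)
                = left_factor K u t * u t * right_factor T K u t) \<and>
         (\<forall>t1 t2. t1 < t2 \<and> t2 \<le> T \<longrightarrow>
            tensor_biproj T t1 t2 (KK \<odot> UU)
              = diag (left_factor K u t1) ** middle_factor K u t1 t2
                  ** diag (right_factor T K u t2))"
proof -
  have "KK = path_tensor T K"
    unfolding assms(3,4) exp_cost_tensor ..
  with assms(5) show ?thesis
    by (simp add: tensor_proj_path_outer tensor_biproj_path_outer)
qed

end
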